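(* Let $P_0,Q_0$ be probability measures on $(\mathbb R,\mathcal B)$ (not necessarily continuous) with $$k(P_0\otimes Q_0):=\int 1_{\{(x,y)\in\mathbb R^2:x\ge y\}}\,dP_0\otimes Q_0=\tfrac12.$$ Let $(n_1)_n,(n_2)_n\subset\mathbb N$ satisfy $n_1+n_2=n$ for all $n$ and $\lim_{n\to\infty}\frac{n_2}n=d\in(0,1)$, and let $X_1,\dots,X_{n_1},Y_1,\dots,Y_{n_2}$ be the coordinate variables on $\mathbb R^{n_1}\times\mathbb R^{n_2}$. Put $$T_n=\frac{\sqrt n}{n_1}\sum_{i=1}^{n_1}Q_0\bigl((-\infty,X_i]\bigr)+\frac{\sqrt n}{n_2}\sum_{j=1}^{n_2}P_0\bigl([Y_j,+\infty)\bigr)-\sqrt n,$$ $$\widetilde T_n=\frac{\sqrt n}{n_1n_2}\sum_{i=1}^{n_1}\sum_{j=1}^{n_2}\mathbf 1_{(-\infty,X_i]}(Y_j)-\frac12\sqrt n.$$ Then for all $\varepsilon>0$, $$\lim_{n\to\infty}P_0^{n_1}\otimes Q_0^{n_2}\bigl(|T_n-\widetilde T_n|>\varepsilon\bigr)=0.$$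
   Context: $\mathcal B$ is the Borel $\sigma$-algebra of $\mathbb R$. Under $P_0^{n_1}\otimes Q_0^{n_2}$ the $X_i$ are i.i.d. with law $P_0$, the $Y_j$ are i.i.d. with law $Q_0$, and the two samples are independent. *)

theory Defs
  imports "HOL-Probability.Probability"
begin

definition k_functional :: "(real \<times> real) measure \<Rightarrow> real" where
  "k_functional \<mu> = (\<integral>z. indicator {(x, y). x \<ge> y} z \<partial>\<mu>)"

text \<open>The samples \<open>X\<^sub>1, \<dots>, X\<^sub>m\<close> and \<open>Y\<^sub>1, \<dots>, Y\<^sub>k\<close> are the coordinates of the two
  components of a point of this product space.\<close>

definition two_sample_measure ::
  "real measure \<Rightarrow> real measure \<Rightarrow> nat \<Rightarrow> nat \<Rightarrow> ((nat \<Rightarrow> real) \<times> (nat \<Rightarrow> real)) measure" where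
  "two_sample_measure P Q m k = (\<Pi>\<^sub>M i\<in>{1..m}. P) \<Otimes>\<^sub>M (\<Pi>\<^sub>M j\<in>{1..k}. Q)"

text \<open>In both statistics \<open>m\<close> and \<open>k\<close> are the two sample sizes and \<open>n\<close> the total size. Division by
  zero (an empty sample) yields 0; under \<open>k / n \<longlonglongrightarrow> d \<in> (0, 1)\<close> this concerns only finitely many
  \<open>n\<close>.\<close>

definition T_stat ::
  "real measure \<Rightarrow> real measure \<Rightarrow> nat \<Rightarrow> nat \<Rightarrow> nat \<Rightarrow> (nat \<Rightarrow> real) \<Rightarrow> (nat \<Rightarrow> real) \<Rightarrow> real" where
  "T_stat P Q n m k X Y =
     sqrt (real n) / real m * (\<Sum>i=1..m. measure Q {..X i})
     + sqrt (real n) / real k * (\<Sum>j=1..k. measure P {Y j..})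
     - sqrt (real n)"

definition T_tilde_stat ::
  "nat \<Rightarrow> nat \<Rightarrow> nat \<Rightarrow> (nat \<Rightarrow> real) \<Rightarrow> (nat \<Rightarrow> real) \<Rightarrow> real" where
  "T_tilde_stat n m k X Y =
     sqrt (real n) / (real m * real k) * (\<Sum>i=1..m. \<Sum>j=1..k. indicator {..X i} (Y j))
     - 1/2 * sqrt (real n)"

end

(* The difference of the two statistics is the double sum of the doubly centred kernel
   h(x, y) = F(x) + G(y) - 1/2 - 1{y <= x}, where F(x) = Q((-oo, x]) and G(y) = P([y, oo)), scaled by
   sqrt n / (n1 n2). Both marginal integrals of h vanish, so the n1 n2 summands are orthogonal in L^2.
   Hence the second moment of the difference is n / (n1 n2) times the integral of h^2, which is O(1/n),
   and Chebyshev's inequality finishes the proof. *)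
theory Submission
  imports Defs
begin

section \<open>Second moments of sums of centred terms on product spaces\<close>

lemma abs_le_imp_power2_le: "\<bar>x\<bar> \<le> B \<Longrightarrow> x\<^sup>2 \<le> B\<^sup>2" for x B :: real
  by (rule power2_le_iff_abs_le[THEN iffD2]) linarith+

text \<open>Induction on the index set: integrating out one further coordinate kills the cross term
  because \<open>u\<close> is centred, so each coordinate adds exactly one copy of the second moment
  of \<open>u\<close>. The bound \<open>B\<close> supplies all integrability.\<close>

lemma (in prob_space) integral_PiM_sum_square:
  fixes u :: "'a \<Rightarrow> real"
  assumes "finite I" and u[measurable]: "u \<in> borel_measurable M"
    and bounded: "\<And>x. x \<in> space M \<Longrightarrow> \<bar>u x\<bar> \<le> B" and centred: "(\<integral>x. u x \<partial>M) = 0"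
  shows "(\<integral>x. (\<Sum>i\<in>I. u (x i))\<^sup>2 \<partial>(\<Pi>\<^sub>M i\<in>I. M)) = real (card I) * (\<integral>x. (u x)\<^sup>2 \<partial>M)"
  using \<open>finite I\<close>
proof (induction I)
  case empty
  show ?case by simp
next
  case (insert i I)
  interpret PS: product_prob_space "\<lambda>_. M" ..
  have B: "B \<ge> 0"
    using bounded not_empty by fastforce
  have bounded_sum: "\<bar>\<Sum>j\<in>J. u (x j)\<bar> \<le> real (card J) * B" if "x \<in> space (\<Pi>\<^sub>M i\<in>J. M)" for x J
    by (rule order_trans[OF sum_abs sum_bounded_above])
       (use that in \<open>auto intro!: bounded simp: space_PiM\<close>)
  have int_sq: "integrable (\<Pi>\<^sub>M i\<in>J. M) (\<lambda>x. (\<Sum>j\<in>J. u (x j))\<^sup>2)" for J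
  proof -
    interpret PJ: prob_space "\<Pi>\<^sub>M i\<in>J. M"
      by (rule prob_space_PiM) (rule prob_space_axioms)
    show ?thesis
      by (rule PJ.integrable_const_bound[where B = "(real (card J) * B)\<^sup>2"])
         (auto intro!: AE_I2 abs_le_imp_power2_le[OF bounded_sum])
  qed
  have int_u: "integrable M u"
    by (rule integrable_const_bound[where B = B]) (auto intro!: AE_I2 bounded)
  have int_u2: "integrable M (\<lambda>x. (u x)\<^sup>2)"
    by (rule integrable_const_bound[where B = "B\<^sup>2"])
       (auto intro!: AE_I2 abs_le_imp_power2_le[OF bounded])
  interpret PI: prob_space "\<Pi>\<^sub>M i\<in>I. M"
    by (rule prob_space_PiM) (rule prob_space_axioms)
  have inner: "(\<integral>y. (\<Sum>j\<in>insert i I. u ((x(i := y)) j))\<^sup>2 \<partial>M)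
      = (\<Sum>j\<in>I. u (x j))\<^sup>2 + (\<integral>y. (u y)\<^sup>2 \<partial>M)" for x
  proof -
    \<comment> \<open>As \<open>i\<close> lies outside \<open>I\<close>, updating \<open>x\<close>
      at \<open>i\<close> leaves this partial sum unchanged; it is a constant for the integral over
      \<open>y\<close>.\<close>
    define s where "s = (\<Sum>j\<in>I. u (x j))"
    have "(\<Sum>j\<in>insert i I. u ((x(i := y)) j)) = u y + s" for y
      unfolding s_def using insert.hyps by (auto intro!: sum.cong)
    then have "(\<integral>y. (\<Sum>j\<in>insert i I. u ((x(i := y)) j))\<^sup>2 \<partial>M)
        = (\<integral>y. s\<^sup>2 + (2 * s) * u y + (u y)\<^sup>2 \<partial>M)"
      by (simp add: power2_sum algebra_simps)
    also have "\<dots> = s\<^sup>2 + (\<integral>y. (u y)\<^sup>2 \<partial>M)"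
      using int_u int_u2 centred by (simp add: prob_space)
    finally show ?thesis by (simp add: s_def)
  qed
  show ?case
    unfolding PS.product_integral_insert[OF insert.hyps int_sq] inner
    using insert int_sq[of I] by (simp add: PI.prob_space algebra_simps)
qed

text \<open>The one-sample identity is applied twice. With the second sample frozen, the double sum
  is a sum over \<open>I\<close> of one function of a single coordinate, the row sum
  \<open>\<Sum>j\<in>J. h a (y j)\<close>; with \<open>a\<close> frozen, the row sum is itself such
  a sum over \<open>J\<close>. The two centring hypotheses serve these two applications in
  turn.\<close>

lemma (in pair_prob_space) integral_PiM_double_sum_square:
  fixes h :: "'a \<Rightarrow> 'b \<Rightarrow> real"
  assumes fin: "finite I" "finite J"
    and h[measurable]: "case_prod h \<in> borel_measurable (M1 \<Otimes>\<^sub>M M2)"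
    and bounded: "\<And>x y. x \<in> space M1 \<Longrightarrow> y \<in> space M2 \<Longrightarrow> \<bar>h x y\<bar> \<le> B"
    and centred1: "\<And>y. y \<in> space M2 \<Longrightarrow> (\<integral>x. h x y \<partial>M1) = 0"
    and centred2: "\<And>x. x \<in> space M1 \<Longrightarrow> (\<integral>y. h x y \<partial>M2) = 0"
  shows "(\<integral>z. (\<Sum>i\<in>I. \<Sum>j\<in>J. h (fst z i) (snd z j))\<^sup>2 \<partial>((\<Pi>\<^sub>M i\<in>I. M1) \<Otimes>\<^sub>M (\<Pi>\<^sub>M j\<in>J. M2)))
    = real (card I) * real (card J) * (\<integral>x. (\<integral>y. (h x y)\<^sup>2 \<partial>M2) \<partial>M1)"
proof -
  let ?PI = "\<Pi>\<^sub>M i\<in>I. M1" and ?PJ = "\<Pi>\<^sub>M j\<in>J. M2"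
  interpret PI: prob_space ?PI
    by (rule prob_space_PiM) (rule M1.prob_space_axioms)
  interpret PJ: prob_space ?PJ
    by (rule prob_space_PiM) (rule M2.prob_space_axioms)
  interpret PIJ: pair_prob_space ?PI ?PJ ..
  \<comment> \<open>One point of the first space against the whole second sample: the setting that
    remains once the sum over \<open>I\<close> has been collapsed.\<close>
  interpret P1J: pair_prob_space M1 ?PJ ..
  have row_bound: "\<bar>\<Sum>j\<in>J. h a (y j)\<bar> \<le> real (card J) * B"
    if "a \<in> space M1" "y \<in> space ?PJ" for a y
    by (rule order_trans[OF sum_abs sum_bounded_above])
       (use that in \<open>auto intro!: bounded simp: space_PiM\<close>)
  have all_bound: "\<bar>\<Sum>i\<in>I. \<Sum>j\<in>J. h (x i) (y j)\<bar> \<le> real (card I) * (real (card J) * B)"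
    if "x \<in> space ?PI" "y \<in> space ?PJ" for x y
    by (rule order_trans[OF sum_abs sum_bounded_above])
       (use that in \<open>auto intro!: row_bound simp: space_PiM\<close>)
  have int_all: "integrable (?PI \<Otimes>\<^sub>M ?PJ) (\<lambda>(x, y). (\<Sum>i\<in>I. \<Sum>j\<in>J. h (x i) (y j))\<^sup>2)"
    by (rule PIJ.integrable_const_bound[where B = "(real (card I) * (real (card J) * B))\<^sup>2"])
       (auto intro!: AE_I2 abs_le_imp_power2_le[OF all_bound] simp: space_pair_measure)
  have int_row: "integrable (M1 \<Otimes>\<^sub>M ?PJ) (\<lambda>(a, y). (\<Sum>j\<in>J. h a (y j))\<^sup>2)"
    by (rule P1J.integrable_const_bound[where B = "(real (card J) * B)\<^sup>2"])
       (auto intro!: AE_I2 abs_le_imp_power2_le[OF row_bound] simp: space_pair_measure)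
  have row_centred: "(\<integral>a. (\<Sum>j\<in>J. h a (y j)) \<partial>M1) = 0" if "y \<in> space ?PJ" for y
  proof -
    have y: "y j \<in> space M2" if "j \<in> J" for j
      using that \<open>y \<in> space ?PJ\<close> by (auto simp: space_PiM)
    have "integrable M1 (\<lambda>a. h a (y j))" if "j \<in> J" for j
      by (rule M1.integrable_const_bound[where B = B])
         (use y[OF that] in \<open>auto intro!: AE_I2 bounded\<close>)
    then show ?thesis
      using y by (simp add: centred1)
  qed
  have "(\<integral>z. (\<Sum>i\<in>I. \<Sum>j\<in>J. h (fst z i) (snd z j))\<^sup>2 \<partial>(?PI \<Otimes>\<^sub>M ?PJ))
      = (\<integral>y. (\<integral>x. (\<Sum>i\<in>I. \<Sum>j\<in>J. h (x i) (y j))\<^sup>2 \<partial>?PI) \<partial>?PJ)"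
    using PIJ.integral_snd[OF int_all] by (simp add: case_prod_beta')
  also have "\<dots> = (\<integral>y. real (card I) * (\<integral>a. (\<Sum>j\<in>J. h a (y j))\<^sup>2 \<partial>M1) \<partial>?PJ)"
  proof (rule Bochner_Integration.integral_cong[OF refl])
    fix y assume y[measurable]: "y \<in> space ?PJ"
    have [measurable]: "y j \<in> space M2" if "j \<in> J" for j
      using that y by (auto simp: space_PiM)
    show "(\<integral>x. (\<Sum>i\<in>I. \<Sum>j\<in>J. h (x i) (y j))\<^sup>2 \<partial>?PI)
        = real (card I) * (\<integral>a. (\<Sum>j\<in>J. h a (y j))\<^sup>2 \<partial>M1)"
      by (rule M1.integral_PiM_sum_square[OF fin(1) _ row_bound row_centred]) (use y in auto)
  qed
  \<comment> \<open>Fubini turns the order round, so that \<open>a\<close> is fixed and the second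
    sample is integrated first.\<close>
  also have "\<dots> = real (card I) * (\<integral>a. (\<integral>y. (\<Sum>j\<in>J. h a (y j))\<^sup>2 \<partial>?PJ) \<partial>M1)"
    using P1J.Fubini_integral[OF int_row] by simp
  also have "(\<integral>a. (\<integral>y. (\<Sum>j\<in>J. h a (y j))\<^sup>2 \<partial>?PJ) \<partial>M1)
      = (\<integral>a. real (card J) * (\<integral>b. (h a b)\<^sup>2 \<partial>M2) \<partial>M1)"
  proof (rule Bochner_Integration.integral_cong[OF refl])
    fix a assume a[measurable]: "a \<in> space M1"
    show "(\<integral>y. (\<Sum>j\<in>J. h a (y j))\<^sup>2 \<partial>?PJ) = real (card J) * (\<integral>b. (h a b)\<^sup>2 \<partial>M2)"
      by (rule M2.integral_PiM_sum_square[OF fin(2) _ bounded[OF a] centred2[OF a]]) auto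
  qed
  finally show ?thesis by simp
qed

section \<open>The doubly centred kernel and its marginal integrals\<close>

text \<open>When \<open>k_functional\<close> is 1/2, this is the negative of the degenerate term in
  the Hoeffding decomposition of the kernel \<open>indicator {..x} y\<close>.\<close>

definition centred_kernel :: "real measure \<Rightarrow> real measure \<Rightarrow> real \<Rightarrow> real \<Rightarrow> real" where
  "centred_kernel P Q x y = measure Q {..x} + measure P {y..} - 1/2 - indicator {..x} y"

locale two_real_distributions = P: real_distribution P + Q: real_distribution Q
  for P Q :: "real measure"
begin

sublocale pair: pair_prob_space P Q ..

lemma borel_measurable_lower_measure[measurable]: "(\<lambda>x. measure Q {..x}) \<in> borel_measurable borel"
  by (rule borel_measurable_mono) (auto intro!: monoI Q.finite_measure_mono)

lemma borel_measurable_upper_measure[measurable]: "(\<lambda>y. measure P {y..}) \<in> borel_measurable borel"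
proof -
  \<comment> \<open>The upper tail is antitone in \<open>y\<close>; the sign change makes it
    monotone, hence Borel.\<close>
  have "(\<lambda>y. - measure P {y..}) \<in> borel_measurable borel"
    by (rule borel_measurable_mono) (auto intro!: monoI P.finite_measure_mono)
  then have "(\<lambda>y. - (- measure P {y..})) \<in> borel_measurable borel"
    by (rule borel_measurable_uminus)
  then show ?thesis by simp
qed

lemma borel_measurable_centred_kernel[measurable]:
  "case_prod (centred_kernel P Q) \<in> borel_measurable (borel \<Otimes>\<^sub>M borel)"
proof -
  have [simp]: "indicator {..x} y = (if y \<le> x then 1 else 0 :: real)" for x y :: real
    by (simp add: indicator_def)
  show ?thesis
    unfolding centred_kernel_def by (simp add: case_prod_beta')
qed

text \<open>Both measures and the indicator lie in [0, 1], so the extreme values are 1 + 1 - 1/2 - 0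
  and 0 + 0 - 1/2 - 1.\<close>

lemma abs_centred_kernel_le: "\<bar>centred_kernel P Q x y\<bar> \<le> 3/2"
proof -
  have "0 \<le> (indicator {..x} y :: real)" "(indicator {..x} y :: real) \<le> 1"
    by (simp_all add: indicator_def)
  then show ?thesis
    using P.prob_le_1[of "{y..}"] Q.prob_le_1[of "{..x}"]
      measure_nonneg[of P "{y..}"] measure_nonneg[of Q "{..x}"]
    unfolding centred_kernel_def abs_le_iff by linarith
qed

lemma integrable_lower_measure: "integrable P (\<lambda>x. measure Q {..x})"
  by (rule P.integrable_const_bound[where B = 1]) (auto intro!: AE_I2)

lemma integrable_upper_measure: "integrable Q (\<lambda>y. measure P {y..})"
  by (rule Q.integrable_const_bound[where B = 1]) (auto intro!: AE_I2)

lemma integrable_le_indicator: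
  "integrable (P \<Otimes>\<^sub>M Q) (\<lambda>(x, y). indicator {(x, y). x \<ge> y} (x, y) :: real)"
  by (rule pair.integrable_const_bound[where B = 1]) (auto intro!: AE_I2 simp: indicator_def)

text \<open>Fubini: \<open>{..x}\<close> is the section of the set x \<ge> y at fixed x. The section
  at fixed y is \<open>{y..}\<close>, which gives the companion identity. Both sections contain the
  tie x = y, so the identities hold in the presence of atoms.\<close>

lemma integral_lower_measure: "(\<integral>x. measure Q {..x} \<partial>P) = k_functional (P \<Otimes>\<^sub>M Q)"
proof -
  have "(\<integral>x. (\<integral>y. indicator {(x, y). x \<ge> y} (x, y) \<partial>Q) \<partial>P) = k_functional (P \<Otimes>\<^sub>M Q)"
    using pair.integral_fst'[OF integrable_le_indicator] by (simp add: k_functional_def)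
  moreover have "(\<integral>y. indicator {(x, y). x \<ge> y} (x, y) \<partial>Q) = measure Q {..x}" for x :: real
  proof -
    have "(\<lambda>y. indicator {(x, y). x \<ge> y} (x, y) :: real) = indicator {..x}"
      by (auto simp: indicator_def)
    then show ?thesis by simp
  qed
  ultimately show ?thesis by simp
qed

lemma integral_upper_measure: "(\<integral>y. measure P {y..} \<partial>Q) = k_functional (P \<Otimes>\<^sub>M Q)"
proof -
  have "(\<integral>y. (\<integral>x. indicator {(x, y). x \<ge> y} (x, y) \<partial>P) \<partial>Q) = k_functional (P \<Otimes>\<^sub>M Q)"
    using pair.integral_snd[OF integrable_le_indicator] by (simp add: k_functional_def)
  moreover have "(\<integral>x. indicator {(x, y). x \<ge> y} (x, y) \<partial>P) = measure P {y..}" for y :: real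
  proof -
    have "(\<lambda>x. indicator {(x, y). x \<ge> y} (x, y) :: real) = indicator {y..}"
      by (auto simp: indicator_def)
    then show ?thesis by simp
  qed
  ultimately show ?thesis by simp
qed

lemma integral_centred_kernel_fst:
  assumes "k_functional (P \<Otimes>\<^sub>M Q) = 1/2"
  shows "(\<integral>x. centred_kernel P Q x y \<partial>P) = 0"
proof -
  \<comment> \<open>Read as a function of \<open>x\<close>, the indicator is that of
    \<open>{y..}\<close>, whose integral cancels \<open>measure P {y..}\<close>; what remains is
    \<open>k_functional\<close> minus 1/2.\<close>
  have "(\<lambda>x. centred_kernel P Q x y) = (\<lambda>x. measure Q {..x} + (measure P {y..} - 1/2) - indicator {y..} x)"
    by (auto simp: centred_kernel_def indicator_def)
  then show ?thesis
    using integrable_lower_measure integrable_real_indicator[of "{y..}" P] assms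
    by (simp add: integral_lower_measure P.prob_space[simplified] P.emeasure_finite less_top[symmetric])
qed

lemma integral_centred_kernel_snd:
  assumes "k_functional (P \<Otimes>\<^sub>M Q) = 1/2"
  shows "(\<integral>y. centred_kernel P Q x y \<partial>Q) = 0"
proof -
  have "(\<lambda>y. centred_kernel P Q x y) = (\<lambda>y. measure P {y..} + (measure Q {..x} - 1/2) - indicator {..x} y)"
    by (auto simp: centred_kernel_def)
  then show ?thesis
    using integrable_upper_measure integrable_real_indicator[of "{..x}" Q] assms
    by (simp add: integral_upper_measure Q.prob_space[simplified] Q.emeasure_finite less_top[symmetric])
qed

section \<open>The difference of the statistics and its tail bound\<close>

text \<open>A term depending on one index only is repeated \<open>k\<close> or \<open>m\<close>
  times in the double sum, and positivity lets these factors cancel against the scaling. The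
  constants match since - sqrt n + sqrt n / 2 = - sqrt n / 2.\<close>

lemma T_stat_minus_T_tilde_stat:
  assumes "m > 0" "k > 0"
  shows "T_stat P Q n m k X Y - T_tilde_stat n m k X Y
    = sqrt (real n) / (real m * real k) * (\<Sum>i=1..m. \<Sum>j=1..k. centred_kernel P Q (X i) (Y j))"
proof -
  have "(\<Sum>i=1..m. \<Sum>j=1..k. centred_kernel P Q (X i) (Y j))
      = real k * (\<Sum>i=1..m. measure Q {..X i}) + real m * (\<Sum>j=1..k. measure P {Y j..})
        - real m * real k / 2 - (\<Sum>i=1..m. \<Sum>j=1..k. indicator {..X i} (Y j))"
    unfolding centred_kernel_def by (simp add: sum.distrib sum_subtractf sum_distrib_left)
  then show ?thesis
    unfolding T_stat_def T_tilde_stat_def using assms by (simp add: divide_simps) algebra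
qed

text \<open>Chebyshev's inequality: the squared scaling n / (m k)^2 times the m k equal
  contributions leaves n / (m k), and 9/4 is the square of the kernel bound 3/2.\<close>

lemma measure_statistics_differ_le:
  assumes k_half: "k_functional (P \<Otimes>\<^sub>M Q) = 1/2" and pos: "m > 0" "k > 0" "\<epsilon> > 0"
  shows "measure (two_sample_measure P Q m k)
      {(X, Y) \<in> space (two_sample_measure P Q m k).
        \<bar>T_stat P Q n m k X Y - T_tilde_stat n m k X Y\<bar> > \<epsilon>}
    \<le> 9/4 * (real n / (real m * real k)) / \<epsilon>\<^sup>2"
proof -
  let ?h = "centred_kernel P Q" and ?PX = "\<Pi>\<^sub>M i\<in>{1..m}. P" and ?PY = "\<Pi>\<^sub>M j\<in>{1..k}. Q"
  let ?c = "sqrt (real n) / (real m * real k)"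
  let ?S = "\<lambda>z. \<Sum>i=1..m. \<Sum>j=1..k. ?h (fst z i) (snd z j)"
  interpret PX: prob_space ?PX
    by (rule prob_space_PiM) (rule P.prob_space_axioms)
  interpret PY: prob_space ?PY
    by (rule prob_space_PiM) (rule Q.prob_space_axioms)
  interpret PXY: pair_prob_space ?PX ?PY ..
  have S_meas[measurable]: "?S \<in> borel_measurable (?PX \<Otimes>\<^sub>M ?PY)"
    by measurable
  have S_bound: "\<bar>?S z\<bar> \<le> real m * (real k * (3/2))" for z
  proof -
    have "\<bar>\<Sum>j=1..k. ?h (fst z i) (snd z j)\<bar> \<le> real k * (3/2)" for i
      using order_trans[OF sum_abs sum_bounded_above[where A = "{1..k}" and K = "3/2"]]
        abs_centred_kernel_le by (metis (no_types, lifting) card_atLeastAtMost diff_Suc_1)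
    then show ?thesis
      using order_trans[OF sum_abs sum_bounded_above[where A = "{1..m}" and K = "real k * (3/2)"]]
      by (metis (no_types, lifting) card_atLeastAtMost diff_Suc_1)
  qed
  have "integrable (?PX \<Otimes>\<^sub>M ?PY) (\<lambda>z. (?S z)\<^sup>2)"
    by (rule PXY.integrable_const_bound[where B = "(real m * (real k * (3/2)))\<^sup>2"])
       (simp_all only: real_norm_def abs_power2 abs_le_imp_power2_le[OF S_bound] AE_I2, measurable)
  then have int: "integrable (?PX \<Otimes>\<^sub>M ?PY) (\<lambda>z. (?c * ?S z)\<^sup>2)"
    unfolding power_mult_distrib by (rule integrable_mult_right)
  \<comment> \<open>The bound 9/4 on the squared kernel, cleared of its denominator as
    simplification will present it.\<close>
  have h2: "(?h x y)\<^sup>2 * 4 \<le> 9" for x y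
    using abs_le_imp_power2_le[OF abs_centred_kernel_le[of x y]] by (simp add: power2_eq_square)
  have int_h2: "integrable (P \<Otimes>\<^sub>M Q) (\<lambda>(x, y). (?h x y)\<^sup>2)"
    by (rule pair.integrable_const_bound[where B = "9/4"]) (auto intro!: AE_I2 simp: h2)
  have h2_mean: "(\<integral>x. (\<integral>y. (?h x y)\<^sup>2 \<partial>Q) \<partial>P) \<le> 9/4"
    unfolding pair.integral_fst'[OF int_h2, simplified]
    by (rule pair.integral_le_const[OF int_h2]) (auto intro!: AE_I2 simp: h2)
  \<comment> \<open>Passing to the non-strict event gives the form of Chebyshev's inequality used
    next.\<close>
  have "measure (?PX \<Otimes>\<^sub>M ?PY) {z \<in> space (?PX \<Otimes>\<^sub>M ?PY). \<bar>?c * ?S z\<bar> > \<epsilon>}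
      \<le> measure (?PX \<Otimes>\<^sub>M ?PY) {z \<in> space (?PX \<Otimes>\<^sub>M ?PY). \<bar>?c * ?S z\<bar> \<ge> \<epsilon>}"
    by (rule PXY.finite_measure_mono) auto
  also have "\<dots> \<le> (\<integral>z. (?c * ?S z)\<^sup>2 \<partial>(?PX \<Otimes>\<^sub>M ?PY)) / \<epsilon>\<^sup>2"
    by (rule PXY.second_moment_method[OF _ int pos(3)]) measurable
  also have "(\<integral>z. (?c * ?S z)\<^sup>2 \<partial>(?PX \<Otimes>\<^sub>M ?PY)) = ?c\<^sup>2 * (\<integral>z. (?S z)\<^sup>2 \<partial>(?PX \<Otimes>\<^sub>M ?PY))"
    by (simp only: power_mult_distrib integral_mult_right_zero)
  also have "(\<integral>z. (?S z)\<^sup>2 \<partial>(?PX \<Otimes>\<^sub>M ?PY)) = real m * real k * (\<integral>x. (\<integral>y. (?h x y)\<^sup>2 \<partial>Q) \<partial>P)"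
    using pair.integral_PiM_double_sum_square[of "{1..m}" "{1..k}" ?h "3/2"]
      integral_centred_kernel_fst[OF k_half] integral_centred_kernel_snd[OF k_half]
      abs_centred_kernel_le by simp
  also have "?c\<^sup>2 * (real m * real k * (\<integral>x. (\<integral>y. (?h x y)\<^sup>2 \<partial>Q) \<partial>P))
      = real n / (real m * real k) * (\<integral>x. (\<integral>y. (?h x y)\<^sup>2 \<partial>Q) \<partial>P)"
    using pos by (simp add: power_divide power2_eq_square)
  also have "\<dots> / \<epsilon>\<^sup>2 \<le> real n / (real m * real k) * (9/4) / \<epsilon>\<^sup>2"
    by (intro divide_right_mono mult_left_mono h2_mean) auto
  finally show ?thesis
    unfolding two_sample_measure_def T_stat_minus_T_tilde_stat[OF pos(1,2)]
    by (simp add: case_prod_beta' mult.commute)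
qed

end

section \<open>Passage to the limit\<close>

theorem lemma5p10:
  fixes P0 Q0 :: "real measure"
    and n1 n2 :: "nat \<Rightarrow> nat"
    and d :: real
  assumes "real_distribution P0" and "real_distribution Q0"
    and "k_functional (P0 \<Otimes>\<^sub>M Q0) = 1/2"
    and "\<And>n. n1 n + n2 n = n"
    and "(\<lambda>n. real (n2 n) / real n) \<longlonglongrightarrow> d"
    and "0 < d" and "d < 1"
  shows "\<forall>\<epsilon>>0. (\<lambda>n. measure (two_sample_measure P0 Q0 (n1 n) (n2 n))
      {(X, Y) \<in> space (two_sample_measure P0 Q0 (n1 n) (n2 n)).
        \<bar>T_stat P0 Q0 n (n1 n) (n2 n) X Y - T_tilde_stat n (n1 n) (n2 n) X Y\<bar> > \<epsilon>}) \<longlonglongrightarrow> 0"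
proof (intro allI impI)
  fix \<epsilon> :: real assume "\<epsilon> > 0"
  interpret two_real_distributions P0 Q0
    using assms(1,2) by (simp add: two_real_distributions_def)
  let ?r = "\<lambda>n. real (n2 n) / real n"
  have n1_eq: "real (n1 n) = real n - real (n2 n)" for n
    using assms(4)[of n] by linarith
  \<comment> \<open>The ratio \<open>n2 n / n\<close> is eventually strictly between 0 and 1, which
    rules out an empty sample on either side.\<close>
  have pos: "\<forall>\<^sub>F n in sequentially. 0 < n1 n \<and> 0 < n2 n \<and> 0 < n"
    using order_tendstoD(1)[OF assms(5,6)] order_tendstoD(2)[OF assms(5,7)]
      eventually_gt_at_top[of 0]
  proof eventually_elim
    case (elim n)
    then show ?case
      using n1_eq[of n] by (auto simp: divide_simps intro!: Nat.gr0I)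
  qed
  \<comment> \<open>With r = n2 / n, the factor n / (n1 n2) equals (1 / n) / ((1 - r) r). Its
    denominator tends to (1 - d) d, nonzero because 0 < d < 1, so the Chebyshev bound vanishes in
    the limit.\<close>
  have "(\<lambda>n. 9/4 * ((1 / real n) / ((1 - ?r n) * ?r n)) / \<epsilon>\<^sup>2) \<longlonglongrightarrow> 9/4 * (0 / ((1 - d) * d)) / \<epsilon>\<^sup>2"
    using assms(5,6,7) \<open>\<epsilon> > 0\<close> by (intro tendsto_intros lim_const_over_n) auto
  moreover have "\<forall>\<^sub>F n in sequentially. 9/4 * ((1 / real n) / ((1 - ?r n) * ?r n)) / \<epsilon>\<^sup>2
      = 9/4 * (real n / (real (n1 n) * real (n2 n))) / \<epsilon>\<^sup>2"
    using pos by eventually_elim (simp add: n1_eq field_simps)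
  ultimately have bound: "(\<lambda>n. 9/4 * (real n / (real (n1 n) * real (n2 n))) / \<epsilon>\<^sup>2) \<longlonglongrightarrow> 0"
    by (simp add: tendsto_cong)
  show "(\<lambda>n. measure (two_sample_measure P0 Q0 (n1 n) (n2 n))
      {(X, Y) \<in> space (two_sample_measure P0 Q0 (n1 n) (n2 n)).
        \<bar>T_stat P0 Q0 n (n1 n) (n2 n) X Y - T_tilde_stat n (n1 n) (n2 n) X Y\<bar> > \<epsilon>}) \<longlonglongrightarrow> 0"
  proof (rule tendsto_sandwich[OF _ _ tendsto_const bound])
    show "\<forall>\<^sub>F n in sequentially. measure (two_sample_measure P0 Q0 (n1 n) (n2 n))
        {(X, Y) \<in> space (two_sample_measure P0 Q0 (n1 n) (n2 n)).
          \<bar>T_stat P0 Q0 n (n1 n) (n2 n) X Y - T_tilde_stat n (n1 n) (n2 n) X Y\<bar> > \<epsilon>}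
        \<le> 9/4 * (real n / (real (n1 n) * real (n2 n))) / \<epsilon>\<^sup>2"
      using pos by eventually_elim (rule measure_statistics_differ_le[OF assms(3) _ _ \<open>\<epsilon> > 0\<close>], auto)
  qed simp
qed

end
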